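(* Let $k$ be an algebraically closed field and let $B=\bigoplus_{n\ge 0}B_n$ be an $\mathbb{N}$-graded $k$-algebra that is a (not necessarily commutative) domain with the property that $B_n$ is finite-dimensional over $k$ for every $n$. Then $B$ is a finite factorization domain.
   Context: $\mathbb{N}$ includes $0$. Algebras are associative and unital, not necessarily commutative. $\mathbb{N}$-graded means that the $B_n$ are $k$-subspaces whose direct sum is $B$ and $B_nB_m\subseteq B_{n+m}$ for all $n,m\ge 0$. A (not necessarily commutative) domain $A$ is a finite factorization domain (FFD) if every nonzero non-unit element of $A$ has at least one factorization $a=a_1\cdots a_m$ into irreducible elements (nonzero non-units that are not a product of two non-units) and at most finitely many distinct such factorizations up to multiplication of the irreducible factors by central units of $A$. (Factorizations are ordered sequences of factors.) *)

theory Defs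
  imports "HOL-Computational_Algebra.Polynomial"
begin

text \<open>
  The library notions of unit and irreducible element (based on \<open>dvd\<close>) are only available for
  commutative structures, so the noncommutative ones are introduced here.
\<close>

definition ring_unit :: "'a::monoid_mult \<Rightarrow> bool" where
  "ring_unit a \<longleftrightarrow> (\<exists>b. a * b = 1 \<and> b * a = 1)"

definition central_unit :: "'a::monoid_mult \<Rightarrow> bool" where
  "central_unit u \<longleftrightarrow> ring_unit u \<and> (\<forall>x. u * x = x * u)"

definition ring_irreducible :: "'a::ring_1 \<Rightarrow> bool" where
  "ring_irreducible a \<longleftrightarrow>
     a \<noteq> 0 \<and> \<not> ring_unit a \<and> (\<forall>b c. a = b * c \<longrightarrow> ring_unit b \<or> ring_unit c)"

text \<open>
  Factorizations are ordered. The empty list has product \<open>1\<close>, so it does not occur as a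
  factorization of a non-unit.
\<close>

definition factorizations :: "'a::ring_1 \<Rightarrow> 'a list set" where
  "factorizations a = {xs. (\<forall>x\<in>set xs. ring_irreducible x) \<and> prod_list xs = a}"

definition factorization_rel :: "'a::ring_1 \<Rightarrow> ('a list \<times> 'a list) set" where
  "factorization_rel a =
     {(xs, ys). xs \<in> factorizations a \<and> ys \<in> factorizations a \<and>
        list_all2 (\<lambda>x y. \<exists>u. central_unit u \<and> y = u * x) xs ys}"

lemma equiv_factorization_rel: "equiv (factorizations a) (factorization_rel a)"
proof -
  let ?R = "\<lambda>x y::'a. \<exists>u. central_unit u \<and> y = u * x"
  have refl: "?R x x" for x
    by (rule exI[of _ 1]) (auto simp: central_unit_def ring_unit_def)
  have sym: "?R y x" if "?R x y" for x y
  proof -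
    from that obtain u v where u: "y = u * x" "\<forall>x. u * x = x * u" "u * v = 1" "v * u = 1"
      by (auto simp: central_unit_def ring_unit_def)
    have "v * z = z * v" for z
    proof -
      have "v * z = v * (z * u) * v" using u(3) by (metis mult.assoc mult_1_right)
      also have "\<dots> = v * (u * z) * v" by (simp only: u(2))
      also have "\<dots> = z * v" using u(4) by (metis mult.assoc mult_1_left)
      finally show ?thesis .
    qed
    moreover have "x = v * y" using u(1,4) by (metis mult.assoc mult_1_left)
    ultimately show ?thesis
      using u unfolding central_unit_def ring_unit_def by blast
  qed
  have trans: "?R x z" if "?R x y" "?R y z" for x y z
  proof -
    from that obtain u v u' v' where
      u: "y = u * x" "\<forall>x. u * x = x * u" "u * v = 1" "v * u = 1" and
      u': "z = u' * y" "\<forall>x. u' * x = x * u'" "u' * v' = 1" "v' * u' = 1"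
      by (auto simp: central_unit_def ring_unit_def)
    have "(u' * u) * (v * v') = u' * (u * v) * v'" "(v * v') * (u' * u) = v * (v' * u') * u"
      by (simp_all only: mult.assoc)
    hence "ring_unit (u' * u)"
      using u u' unfolding ring_unit_def by (metis mult_1_right)
    moreover have "(u' * u) * w = w * (u' * u)" for w
      using u(2) u'(2) by (metis mult.assoc)
    ultimately have "central_unit (u' * u)" by (simp add: central_unit_def)
    thus ?thesis using u(1) u'(1) by (metis mult.assoc)
  qed
  show ?thesis
  proof (rule equivI)
    show "factorization_rel a \<subseteq> factorizations a \<times> factorizations a"
      by (auto simp: factorization_rel_def)
    show "refl_on (factorizations a) (factorization_rel a)"
      using refl by (auto simp: refl_on_def factorization_rel_def intro: list_all2_refl)
    show "Relation.sym (factorization_rel a)"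
      using sym by (auto simp: sym_def factorization_rel_def list_all2_conv_all_nth)
    show "Relation.trans (factorization_rel a)"
    proof (rule transI)
      fix xs ys zs
      assume "(xs, ys) \<in> factorization_rel a" "(ys, zs) \<in> factorization_rel a"
      thus "(xs, zs) \<in> factorization_rel a"
        using list_all2_trans[of ?R ?R ?R xs ys zs, OF trans]
        by (auto simp: factorization_rel_def)
    qed
  qed
qed

text \<open>
  The class \<open>ring_1_no_zero_divisors\<close> comprises the not necessarily commutative, nontrivial domains.
\<close>

definition finite_factorization_domain :: "'a::ring_1_no_zero_divisors itself \<Rightarrow> bool" where
  "finite_factorization_domain _ \<longleftrightarrow>
     (\<forall>a::'a. a \<noteq> 0 \<and> \<not> ring_unit a \<longrightarrow>
        factorizations a \<noteq> {} \<and> finite (factorizations a // factorization_rel a))"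

locale assoc_algebra = vector_space scale
  for scale :: "'k::field \<Rightarrow> 'b::ring_1 \<Rightarrow> 'b" (infixr \<open>*s\<close> 75) +
  assumes scale_mult_left: "(c *s x) * y = c *s (x * y)"
    and scale_mult_right: "x * (c *s y) = c *s (x * y)"

locale nat_graded_algebra = assoc_algebra scale
  for scale :: "'k::field \<Rightarrow> 'b::ring_1 \<Rightarrow> 'b" (infixr \<open>*s\<close> 75) +
  fixes G :: "nat \<Rightarrow> 'b set"
  assumes subspace_component: "subspace (G n)"
    and mult_component: "x \<in> G n \<Longrightarrow> y \<in> G m \<Longrightarrow> x * y \<in> G (n + m)"
    and direct_sum:
      "\<exists>!f. (\<forall>n. f n \<in> G n) \<and> finite {n. f n \<noteq> 0} \<and> b = (\<Sum>n\<in>{n. f n \<noteq> 0}. f n)"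

text \<open>
  The library locale \<open>finite_dimensional_vector_space\<close> only concerns the whole type; this is the
  same condition for a subspace.
\<close>

definition finite_dimensional_subspace ::
    "('k::field \<Rightarrow> 'b::ab_group_add \<Rightarrow> 'b) \<Rightarrow> 'b set \<Rightarrow> bool" where
  "finite_dimensional_subspace scale V \<longleftrightarrow>
     (\<exists>E. finite E \<and> \<not> module.dependent scale E \<and> module.span scale E = V)"

end

theory Submission
  imports Defs "HOL-Library.Function_Algebras"
begin

text \<open>
  The decisive point is that \<open>a \<noteq> 0\<close> has, up to scalars, only finitely many left factors \<open>x\<close> in a
  finite-dimensional subspace whose cofactor \<open>y\<close> also lies in it. The map \<open>(x, y) \<mapsto> x * y\<close> induces
  a linear map on the cone of tensors of rank at most one, which by the absence of zero divisors
  vanishes only at the vertex; such a map has finite fibres. Indeed, if the fibre over \<open>a\<close> were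
  infinite, some coordinate would take infinitely many values on it, and a place of the functions on
  the fibre sending that coordinate to infinity would, after dividing by the dominant coordinate,
  specialise to a rank one tensor \<open>x \<otimes> y\<close> with \<open>x * y = 0\<close>.

  In the graded algebra, the degree is additive and nonzero elements of degree \<open>0\<close> are units, so all
  factors of \<open>a\<close> live in bounded degree, and both existence and finiteness of factorizations follow
  by induction on the degree of \<open>a\<close>.
\<close>

section \<open>Extension of places\<close>

text \<open>
  A homomorphism from a subring of \<open>'r\<close> onto the field \<open>'k\<close> is represented by its graph.
\<close>

locale partial_hom =
  fixes G :: "('r::comm_ring_1 \<times> 'k::field) set"
  assumes one_mem: "(1, 1) \<in> G"
    and add_mem: "(a, b) \<in> G \<Longrightarrow> (c, d) \<in> G \<Longrightarrow> (a + c, b + d) \<in> G"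
    and uminus_mem: "(a, b) \<in> G \<Longrightarrow> (- a, - b) \<in> G"
    and mult_mem: "(a, b) \<in> G \<Longrightarrow> (c, d) \<in> G \<Longrightarrow> (a * c, b * d) \<in> G"
    and zero_right: "(0, b) \<in> G \<Longrightarrow> b = 0"
    and right_total: "\<exists>a. (a, b) \<in> G"
begin

lemma zero_mem: "(0, 0) \<in> G"
  using add_mem[OF one_mem uminus_mem[OF one_mem]] by simp

lemma diff_mem: "(a, b) \<in> G \<Longrightarrow> (c, d) \<in> G \<Longrightarrow> (a - c, b - d) \<in> G"
  using add_mem[of a b "- c" "- d"] uminus_mem[of c d] by simp

lemma unique_value: "(a, b) \<in> G \<Longrightarrow> (a, c) \<in> G \<Longrightarrow> b = c"
  using diff_mem[of a b a c] zero_right by fastforce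

lemma sum_mem: "(\<And>i. i \<in> I \<Longrightarrow> (f i, g i) \<in> G) \<Longrightarrow> (sum f I, sum g I) \<in> G"
  by (induction I rule: infinite_finite_induct) (auto intro: zero_mem add_mem)

text \<open>The graph of the homomorphism that \<open>G\<close> induces, coefficient by coefficient,
  from polynomials over \<open>Domain G\<close> to polynomials over the field.\<close>

definition polys :: "('r poly \<times> 'k poly) set" where
  "polys = {(p, q). \<forall>i. (coeff p i, coeff q i) \<in> G}"

lemma polysI: "(\<And>i. (coeff p i, coeff q i) \<in> G) \<Longrightarrow> (p, q) \<in> polys"
  and polysD: "(p, q) \<in> polys \<Longrightarrow> (coeff p i, coeff q i) \<in> G"
  by (auto simp: polys_def)

lemma polys_zero: "(0, 0) \<in> polys"
  by (rule polysI) (simp add: zero_mem)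

lemma polys_add: "(p, q) \<in> polys \<Longrightarrow> (p', q') \<in> polys \<Longrightarrow> (p + p', q + q') \<in> polys"
  by (auto intro!: polysI add_mem dest: polysD)

lemma polys_diff: "(p, q) \<in> polys \<Longrightarrow> (p', q') \<in> polys \<Longrightarrow> (p - p', q - q') \<in> polys"
  by (auto intro!: polysI diff_mem dest: polysD)

lemma polys_mult: "(p, q) \<in> polys \<Longrightarrow> (p', q') \<in> polys \<Longrightarrow> (p * p', q * q') \<in> polys"
  by (auto intro!: polysI sum_mem mult_mem dest: polysD simp: coeff_mult)

lemma polys_monom: "(a, b) \<in> G \<Longrightarrow> (monom a n, monom b n) \<in> polys"
  by (auto intro!: polysI zero_mem)

lemma polys_sum: "(\<And>i. i \<in> I \<Longrightarrow> (f i, g i) \<in> polys) \<Longrightarrow> (sum f I, sum g I) \<in> polys"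
  by (induction I rule: infinite_finite_induct) (auto intro: polys_zero polys_add)

lemma polys_right_total: "\<exists>p. (p, q) \<in> polys"
proof -
  obtain f where f: "\<And>b. (f b, b) \<in> G"
    using right_total by metis
  have "((\<Sum>i\<le>degree q. monom (f (coeff q i)) i), (\<Sum>i\<le>degree q. monom (coeff q i) i)) \<in> polys"
    by (intro polys_sum polys_monom f)
  then show ?thesis
    by (auto simp: poly_as_sum_of_monoms)
qed

lemma poly_mem:
  assumes "(p, q) \<in> polys" "(a, b) \<in> G"
  shows "(poly p a, poly q b) \<in> G"
  using assms(1)
proof (induction p q rule: poly_induct2)
  case 0
  then show ?case by (simp add: zero_mem)
next
  case (pCons c p d q)
  have "(c, d) \<in> G"
    using polysD[OF pCons.prems, of 0] by simp
  moreover have "(p, q) \<in> polys"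
    using polysD[OF pCons.prems, of "Suc _"] by (auto intro: polysI)
  ultimately show ?case
    using add_mem[OF _ mult_mem[OF assms(2) pCons.IH]] by simp
qed

text \<open>The assumption is what makes simultaneous evaluation at \<open>z\<close> and
  \<open>c\<close> well defined; the set is then the graph of the extension that adjoins
  \<open>z\<close> with value \<open>c\<close>.\<close>

lemma partial_hom_adjoin:
  assumes "\<And>p q. (p, q) \<in> polys \<Longrightarrow> poly p z = 0 \<Longrightarrow> poly q c = 0"
  shows "partial_hom {(poly p z, poly q c) | p q. (p, q) \<in> polys}" (is "partial_hom ?H")
proof
  have mem: "(poly p z, poly q c) \<in> ?H" if "(p, q) \<in> polys" for p q
    using that by blast
  have const: "(a, b) \<in> ?H" if "(a, b) \<in> G" for a b
    using mem[OF polys_monom[OF that, of 0]] by (simp add: poly_monom)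
  show "(1, 1) \<in> ?H"
    by (rule const[OF one_mem])
  show "\<exists>a. (a, b) \<in> ?H" for b
    using right_total[of b] const by blast
  show "b = 0" if b: "(0, b) \<in> ?H" for b
  proof -
    obtain p q where "0 = poly p z" "b = poly q c" "(p, q) \<in> polys"
      using b by blast
    then show ?thesis
      using assms[of p q] by simp
  qed
  show "(- a, - b) \<in> ?H" if ab: "(a, b) \<in> ?H" for a b
  proof -
    obtain p q where "a = poly p z" "b = poly q c" "(p, q) \<in> polys"
      using ab by blast
    then show ?thesis
      using mem[OF polys_diff[OF polys_zero, of p q]] by simp
  qed
  fix a b a' b'
  assume "(a, b) \<in> ?H" "(a', b') \<in> ?H"
  then obtain p q p' q' where
    "a = poly p z" "b = poly q c" "(p, q) \<in> polys"
    "a' = poly p' z" "b' = poly q' c" "(p', q') \<in> polys" by blast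
  then show "(a + a', b + b') \<in> ?H" "(a * a', b * b') \<in> ?H"
    using mem[OF polys_add, of p q p' q'] mem[OF polys_mult, of p q p' q'] by simp_all
qed

text \<open>A pair \<open>(p, 1)\<close> says that the constant coefficient of \<open>p\<close> has
  value 1 and all others have value 0. Multiplying the relation for \<open>z\<close> by
  \<open>w ^ n\<close> reverses its coefficients and gives a relation for \<open>w\<close> with
  image \<open>monom 1 n\<close>.\<close>

lemma reverse_relation:
  assumes p: "(p, 1) \<in> polys" "degree p \<le> n" "poly p z = 0" and zw: "z * w = 1"
  shows "\<exists>r. (r, monom 1 n) \<in> polys \<and> poly r w = 0 \<and> coeff r n = coeff p 0 \<and> degree r \<le> n"
proof (intro exI conjI)
  let ?r = "\<Sum>i\<le>n. monom (coeff p i) (n - i)"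
  have "(?r, \<Sum>i\<le>n. monom (coeff 1 i) (n - i)) \<in> polys"
    by (intro polys_sum polys_monom polysD p)
  also have "(\<Sum>i\<le>n. monom (coeff (1 :: 'k poly) i) (n - i)) = (\<Sum>i\<le>n. if i = 0 then monom 1 n else 0)"
    by (intro sum.cong) auto
  also have "\<dots> = monom 1 n"
    by simp
  finally show "(?r, monom 1 n) \<in> polys" .
  have wz: "w ^ (n - i) = w ^ n * z ^ i" if "i \<le> n" for i
  proof -
    have "w ^ n * z ^ i = w ^ (n - i) * w ^ i * z ^ i"
      using that by (simp flip: power_add)
    also have "\<dots> = w ^ (n - i) * (z * w) ^ i"
      by (simp add: power_mult_distrib mult_ac)
    finally have "w ^ n * z ^ i = w ^ (n - i) * (z * w) ^ i" .
    then show ?thesis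
      by (simp add: zw)
  qed
  have "poly ?r w = (\<Sum>i\<le>n. coeff p i * w ^ (n - i))"
    by (simp add: poly_sum poly_monom)
  also have "\<dots> = w ^ n * (\<Sum>i\<le>n. coeff p i * z ^ i)"
    by (simp add: wz sum_distrib_left mult_ac)
  also have "(\<Sum>i\<le>n. coeff p i * z ^ i) = poly p z"
    unfolding poly_altdef using p(2)
    by (intro sum.mono_neutral_right) (auto simp: coeff_eq_0)
  finally show "poly ?r w = 0"
    using p(3) by simp
  have "coeff ?r n = (\<Sum>i\<le>n. if i = 0 then coeff p 0 else 0)"
    unfolding coeff_sum by (intro sum.cong) auto
  then show "coeff ?r n = coeff p 0"
    by simp
  show "degree ?r \<le> n"
    by (intro degree_sum_le) (auto intro: order.trans[OF degree_monom_le])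
qed

text \<open>The classical degree descent showing that a valuation ring contains \<open>z\<close> or its inverse.\<close>

lemma no_relation_for_both:
  assumes "z * w = 1"
    and "(p, 1) \<in> polys" "degree p \<le> n" "poly p z = 0"
    and "(p', 1) \<in> polys" "degree p' \<le> m" "poly p' w = 0"
  shows False
  using assms
proof (induction "n + m" arbitrary: n m p p' z w rule: less_induct)
  case less
  \<comment> \<open>Lowers the relation with the larger degree bound; stated for fresh variables so
    that it also applies with \<open>z\<close> and \<open>w\<close> exchanged.\<close>
  have step: "\<exists>p''. (p'', 1) \<in> polys \<and> degree p'' \<le> n - 1 \<and> poly p'' z = 0 \<and> 0 < n"
    if zw: "z * w = 1" and p: "(p, 1) \<in> polys" "degree p \<le> n" "poly p z = 0"
      and p': "(p', 1) \<in> polys" "degree p' \<le> m" "poly p' w = 0" and "m \<le> n"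
    for z w p p' m n
  proof -
    \<comment> \<open>A constant \<open>p\<close> vanishing at \<open>z\<close> is 0, yet its
      constant coefficient has value 1.\<close>
    have n: "0 < n"
    proof (rule ccontr)
      assume "\<not> 0 < n"
      then have "coeff p 0 = 0"
        using p by (auto elim!: degree_eq_zeroE)
      then show False
        using polysD[OF p(1), of 0] zero_right[of 1] by simp
    qed
    obtain r where r: "(r, monom 1 m) \<in> polys" "poly r z = 0" "coeff r m = coeff p' 0" "degree r \<le> m"
      using reverse_relation[OF p', of z] zw by (auto simp: mult.commute)
    \<comment> \<open>The terms of degree \<open>n\<close> cancel because
      \<open>coeff r m = coeff p' 0\<close>. Since \<open>0 < n\<close>, \<open>coeff p n\<close>
      has value 0, so the subtracted term leaves the image 1 intact.\<close>
    let ?p = "monom (coeff p' 0) 0 * p - monom (coeff p n) (n - m) * r"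
    have "(?p, monom (coeff 1 0) 0 * 1 - monom (coeff 1 n) (n - m) * monom 1 m) \<in> polys"
      by (intro polys_diff polys_mult polys_monom polysD p p' r)
    then have "(?p, 1) \<in> polys"
      using n by (simp add: monom_0 flip: one_pCons)
    moreover have "poly ?p z = 0"
      by (simp add: p r)
    moreover have "coeff ?p i = 0" if "i > n - 1" for i
    proof (cases "i = n")
      case True
      then show ?thesis
        using \<open>m \<le> n\<close> by (simp add: coeff_monom_mult r)
    next
      case False
      then have "coeff p i = 0" "coeff r (i - (n - m)) = 0"
        using that p(2) r(4) \<open>m \<le> n\<close> by (auto intro!: coeff_eq_0)
      then show ?thesis
        by (simp add: coeff_monom_mult)
    qed
    then have "degree ?p \<le> n - 1"
      by (intro degree_le) auto
    ultimately show ?thesis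
      using n by blast
  qed
  show False
  proof (cases "m \<le> n")
    case True
    from step[OF less.prems True] obtain p'' where
      "(p'', 1) \<in> polys" "degree p'' \<le> n - 1" "poly p'' z = 0" "0 < n" by blast
    then show False
      using less.hyps[of "n - 1" m z w p'' p'] less.prems by auto
  next
    case False
    then have "n \<le> m" by simp
    from step[OF _ less.prems(5-7) less.prems(2-4) this] less.prems(1) obtain p'' where
      "(p'', 1) \<in> polys" "degree p'' \<le> m - 1" "poly p'' w = 0" "0 < m" by (auto simp: mult.commute)
    then show False
      using less.hyps[of n "m - 1" z w p p''] less.prems by auto
  qed
qed

end

section \<open>Maximal extensions by Zorn's lemma\<close>

lemma partial_hom_Union_chain:
  assumes "\<C> \<noteq> {}" "subset.chain (Collect partial_hom) \<C>"
  shows "partial_hom (\<Union>\<C>)"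
proof -
  have hom: "partial_hom G" if "G \<in> \<C>" for G
    using assms(2) that by (auto simp: subset_chain_def)
  have common: "\<exists>G\<in>\<C>. x \<in> G \<and> y \<in> G" if "x \<in> \<Union>\<C>" "y \<in> \<Union>\<C>" for x y
    using assms(2) that unfolding subset_chain_def by blast
  obtain G0 where G0: "G0 \<in> \<C>"
    using assms(1) by blast
  show ?thesis
  proof
    show "(1, 1) \<in> \<Union>\<C>"
      using partial_hom.one_mem[OF hom[OF G0]] G0 by blast
    show "\<exists>a. (a, b) \<in> \<Union>\<C>" for b
      using partial_hom.right_total[OF hom[OF G0], of b] G0 by blast
    show "b = 0" if "(0, b) \<in> \<Union>\<C>" for b
      using that partial_hom.zero_right[OF hom] by (elim UnionE)
    show "(- a, - b) \<in> \<Union>\<C>" if "(a, b) \<in> \<Union>\<C>" for a b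
      using that partial_hom.uminus_mem[OF hom] by (elim UnionE, intro UnionI)
    fix a b c d
    assume "(a, b) \<in> \<Union>\<C>" "(c, d) \<in> \<Union>\<C>"
    then obtain G where "G \<in> \<C>" "(a, b) \<in> G" "(c, d) \<in> G"
      using common by blast
    then show "(a + c, b + d) \<in> \<Union>\<C>" "(a * c, b * d) \<in> \<Union>\<C>"
      using partial_hom.add_mem[OF hom] partial_hom.mult_mem[OF hom] by (intro UnionI[of G]; simp)+
  qed
qed

locale maximal_partial_hom = partial_hom G
  for G :: "('r::comm_ring_1 \<times> 'k::alg_closed_field) set" +
  assumes maximal: "partial_hom H \<Longrightarrow> G \<subseteq> H \<Longrightarrow> H = G"

lemma maximal_partial_hom_exists:
  fixes G :: "('r::comm_ring_1 \<times> 'k::alg_closed_field) set"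
  assumes "partial_hom G"
  obtains H where "maximal_partial_hom H" "G \<subseteq> H"
proof -
  let ?A = "{H. partial_hom H \<and> G \<subseteq> H}"
  have "\<exists>M\<in>?A. \<forall>X\<in>?A. M \<subseteq> X \<longrightarrow> X = M"
  proof (rule subset_Zorn_nonempty)
    show "?A \<noteq> {}"
      using assms by blast
    fix \<C>
    assume \<C>: "\<C> \<noteq> {}" "subset.chain ?A \<C>"
    then have "partial_hom (\<Union>\<C>)"
      by (intro partial_hom_Union_chain) (auto simp: subset_chain_def)
    moreover have "G \<subseteq> \<Union>\<C>"
      using \<C> unfolding subset_chain_def by blast
    ultimately show "\<Union>\<C> \<in> ?A"
      by blast
  qed
  then obtain M where M: "partial_hom M" "G \<subseteq> M" "\<forall>X\<in>?A. M \<subseteq> X \<longrightarrow> X = M"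
    by blast
  then have "X = M" if "partial_hom X" "M \<subseteq> X" for X
    using that by (metis (mono_tags, lifting) mem_Collect_eq order.trans)
  with M(1,2) show thesis
    by (intro that[of M] maximal_partial_hom.intro maximal_partial_hom_axioms.intro)
qed

section \<open>The domain of a maximal homomorphism behaves like a valuation ring\<close>

context maximal_partial_hom
begin

lemma adjoin_mem:
  assumes "\<And>p q. (p, q) \<in> polys \<Longrightarrow> poly p z = 0 \<Longrightarrow> poly q c = 0"
  shows "(z, c) \<in> G"
proof -
  let ?H = "{(poly p z, poly q c) | p q. (p, q) \<in> polys}"
  have "G \<subseteq> ?H"
  proof safe
    fix a b
    assume "(a, b) \<in> G"
    from polys_monom[OF this, of 0] show "\<exists>p q. (a, b) = (poly p z, poly q c) \<and> (p, q) \<in> polys"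
      by (force simp: poly_monom)
  qed
  then have "?H = G"
    by (intro maximal partial_hom_adjoin assms)
  moreover have "(z, c) \<in> ?H"
    using polys_monom[OF one_mem, of 1] by (force simp: poly_monom)
  ultimately show ?thesis
    by simp
qed

text \<open>A Nullstellensatz in one variable: a common root \<open>c\<close> of the images of the
  polynomials vanishing at \<open>z\<close> would allow \<open>z\<close> to be adjoined with value
  \<open>c\<close>. Over an algebraically closed field an ideal without common root contains
  1.\<close>

lemma relation_if_not_in_Domain:
  assumes "z \<notin> Domain G"
  obtains p where "(p, 1) \<in> polys" "poly p z = 0"
proof -
  define I where "I = {q. \<exists>p. (p, q) \<in> polys \<and> poly p z = 0}"
  have no_root: "\<exists>q\<in>I. poly q c \<noteq> 0" for c
    using adjoin_mem[of z c] assms unfolding I_def by blast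
  have ideal_mult: "s * q \<in> I" if q: "q \<in> I" for s q
  proof -
    obtain p where "(p, q) \<in> polys" "poly p z = 0"
      using q unfolding I_def by blast
    moreover obtain r where "(r, s) \<in> polys"
      using polys_right_total by blast
    ultimately show ?thesis
      by (auto simp: I_def intro!: exI[of _ "r * p"] polys_mult)
  qed
  have ideal_diff: "q - q' \<in> I" if qq: "q \<in> I" "q' \<in> I" for q q'
  proof -
    obtain p p' where "(p, q) \<in> polys" "poly p z = 0" "(p', q') \<in> polys" "poly p' z = 0"
      using qq unfolding I_def by blast
    then show ?thesis
      unfolding I_def using polys_diff[of p q p' q'] by (intro CollectI exI[of _ "p - p'"]) simp
  qed
  have "\<exists>q. q \<in> I \<and> q \<noteq> 0"
    using no_root[of 0] by fastforce
  then obtain q where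
    q: "q \<in> I" "q \<noteq> 0" and least: "\<And>q'. q' \<in> I \<Longrightarrow> q' \<noteq> 0 \<Longrightarrow> degree q \<le> degree q'"
    using ex_has_least_nat[of "\<lambda>q. q \<in> I \<and> q \<noteq> 0" _ degree] by blast
  have dvd: "q dvd q'" if "q' \<in> I" for q'
  proof -
    have "q' mod q \<in> I"
      using ideal_diff[OF that ideal_mult[OF q(1), of "q' div q"]] by (simp add: minus_div_mult_eq_mod)
    then have "q' mod q = 0"
      using least degree_mod_less'[of q q'] q(2) by (meson not_le)
    then show ?thesis
      by blast
  qed
  \<comment> \<open>A root of the generator \<open>q\<close> would be a common root of
    \<open>I\<close>.\<close>
  have "degree q = 0"
  proof (rule ccontr)
    assume "degree q \<noteq> 0"
    then obtain c where "poly q c = 0"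
      using alg_closed_imp_poly_has_root by blast
    then show False
      using no_root[of c] dvd poly_mult[of q _ c] by (metis dvdE mult_zero_left)
  qed
  then obtain b where "q = [:b:]"
    by (rule degree_eq_zeroE)
  then have "1 \<in> I"
    using ideal_mult[OF q(1), of "[:inverse b:]"] q(2) by (simp add: one_pCons)
  then show thesis
    using that by (auto simp: I_def)
qed

text \<open>If \<open>w\<close> has a value, the reversed relation for \<open>z\<close> makes it
  nilpotent, hence 0; if not, \<open>z\<close> and \<open>w\<close> both satisfy relations, which
  the degree descent excludes. Inverses are expressed by \<open>z * w = 1\<close> because the ring
  will be one of sequences, not a field.\<close>

theorem valuation_property:
  assumes "z * w = 1" "z \<notin> Domain G"
  shows "(w, 0) \<in> G"
proof -
  obtain p where p: "(p, 1) \<in> polys" "poly p z = 0"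
    using relation_if_not_in_Domain[OF assms(2)] .
  show ?thesis
  proof (cases "w \<in> Domain G")
    case True
    then obtain c where c: "(w, c) \<in> G" by blast
    obtain r where "(r, monom 1 (degree p)) \<in> polys" "poly r w = 0"
      using reverse_relation[OF p(1) order.refl p(2) assms(1)] by blast
    from poly_mem[OF this(1) c] this(2) have "c ^ degree p = 0"
      using zero_right[of "c ^ degree p"] by (simp add: poly_monom)
    then show ?thesis
      using c by auto
  next
    case False
    then obtain p' where "(p', 1) \<in> polys" "poly p' w = 0"
      by (rule relation_if_not_in_Domain)
    then show ?thesis
      using no_relation_for_both[OF assms(1) p(1) order.refl p(2)] by blast
  qed
qed

end

section \<open>Points at infinity of infinite sets of vectors\<close>

text \<open>Selects the dominant coordinate, with \<open>D i j\<close> meaning that the quotient of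
  coordinate \<open>i\<close> by coordinate \<open>j\<close> has a finite value.\<close>

lemma maximal_under_total_transitive:
  assumes "finite J" "J \<noteq> {}"
    and total: "\<And>i j. i \<in> J \<Longrightarrow> j \<in> J \<Longrightarrow> D i j \<or> D j i"
    and trans: "\<And>i j k. i \<in> J \<Longrightarrow> j \<in> J \<Longrightarrow> k \<in> J \<Longrightarrow> D i j \<Longrightarrow> D j k \<Longrightarrow> D i k"
  shows "\<exists>p\<in>J. \<forall>i\<in>J. D i p"
  using assms
proof (induction J rule: finite_ne_induct)
  case (singleton x)
  then show ?case by blast
next
  case (insert x F)
  have "\<exists>p\<in>F. \<forall>i\<in>F. D i p"
  proof (rule insert.IH)
    show "D i j \<or> D j i" if "i \<in> F" "j \<in> F" for i j
      using insert.prems(1)[of i j] that by simp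
    show "D i k" if "i \<in> F" "j \<in> F" "k \<in> F" "D i j" "D j k" for i j k
      using insert.prems(2)[of i j k] that by simp
  qed
  then obtain p where p: "p \<in> F" "\<forall>i\<in>F. D i p"
    by blast
  show ?case
  proof (cases "D x p")
    case True
    then show ?thesis using p by blast
  next
    case False
    then have "D p x" "D x x"
      using insert.prems(1)[of p x] insert.prems(1)[of x x] p by blast+
    moreover have "D i x" if "i \<in> F" for i
      using insert.prems(2)[of i p x] that p \<open>D p x\<close> by blast
    ultimately show ?thesis by blast
  qed
qed

text \<open>An injective sequence takes infinitely many values, so a polynomial is determined by its
  values along \<open>g\<close> and evaluation at 0 is well defined. With \<open>g\<close> the
  inverse of a coordinate, this sends that coordinate to infinity.\<close>

lemma partial_hom_at_zero:
  fixes g :: "nat \<Rightarrow> 'k::field"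
  assumes "inj g"
  shows "partial_hom {((\<lambda>n. poly p (g n)), poly p 0) | p. True}" (is "partial_hom ?G")
proof
  have mem: "((\<lambda>n. poly p (g n)), poly p 0) \<in> ?G" for p
    by blast
  show "(1, 1) \<in> ?G"
    using mem[of 1] by (simp add: one_fun_def)
  show "b = 0" if b: "(0, b) \<in> ?G" for b
  proof -
    obtain p where p: "0 = (\<lambda>n. poly p (g n))" "b = poly p 0"
      using b by blast
    then have "range g \<subseteq> {x. poly p x = 0}"
      by (auto simp: zero_fun_def fun_eq_iff)
    moreover have "infinite (range g)"
      using assms by (simp add: finite_image_iff)
    ultimately have "p = 0"
      using poly_roots_finite finite_subset by blast
    then show ?thesis
      using p by simp
  qed
  show "\<exists>a. (a, b) \<in> ?G" for b
    using mem[of "[:b:]"] by auto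
  show "(- a, - b) \<in> ?G" if ab: "(a, b) \<in> ?G" for a b
  proof -
    obtain p where "a = (\<lambda>n. poly p (g n))" "b = poly p 0"
      using ab by blast
    then show ?thesis
      using mem[of "- p"] by (simp add: fun_Compl_def)
  qed
  fix a b c d
  assume "(a, b) \<in> ?G" "(c, d) \<in> ?G"
  then obtain p q where "a = (\<lambda>n. poly p (g n))" "b = poly p 0" "c = (\<lambda>n. poly q (g n))" "d = poly q 0"
    by blast
  then show "(a + c, b + d) \<in> ?G" "(a * c, b * d) \<in> ?G"
    using mem[of "p + q"] mem[of "p * q"] by (simp_all add: plus_fun_def times_fun_def)
qed

text \<open>
  On a suitable sequence in \<open>S\<close> every coordinate vanishes identically or nowhere, so that the ring
  of sequences contains all the quotients of coordinates to which the valuation is applied.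
\<close>

lemma sequence_with_unbounded_coordinate:
  fixes S :: "('i \<Rightarrow> 'k::zero) set"
  assumes "finite I" "infinite S" and supp: "\<forall>t\<in>S. \<forall>i. i \<notin> I \<longrightarrow> t i = 0"
  obtains x :: "nat \<Rightarrow> 'i \<Rightarrow> 'k" and J i0 where "\<And>n. x n \<in> S" "J \<subseteq> I" "i0 \<in> J" "inj (\<lambda>n. x n i0)"
    "\<And>n i. i \<in> J \<longleftrightarrow> x n i \<noteq> 0"
proof -
  \<comment> \<open>Only finitely many supports occur, so infinitely many points share one.\<close>
  have "finite ((\<lambda>t. {i \<in> I. t i \<noteq> 0}) ` S)"
    by (rule finite_subset[of _ "Pow I"]) (use assms(1) in auto)
  from pigeonhole_infinite[OF assms(2) this] obtain t0 :: "'i \<Rightarrow> 'k" where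
    t0: "infinite {t \<in> S. {i \<in> I. t i \<noteq> 0} = {i \<in> I. t0 i \<noteq> 0}}"
    by blast
  define J where "J = {i \<in> I. t0 i \<noteq> 0}"
  define S' where "S' = {t \<in> S. {i \<in> I. t i \<noteq> 0} = J}"
  have S': "S' \<subseteq> S" "infinite S'" "J \<subseteq> I"
    using t0 by (auto simp: S'_def J_def)
  have J: "i \<in> J \<longleftrightarrow> t i \<noteq> 0" if "t \<in> S'" for t i
    using that supp unfolding S'_def by blast
  \<comment> \<open>Otherwise \<open>S'\<close> would consist of functions supported in the finite
    set \<open>I\<close> with values in a finite set.\<close>
  have "\<exists>i\<in>I. infinite ((\<lambda>t. t i) ` S')"
  proof (rule ccontr)
    assume "\<not> ?thesis"
    then have "finite {f. \<forall>i. (i \<in> I \<longrightarrow> f i \<in> (\<Union>i\<in>I. (\<lambda>t. t i) ` S')) \<and> (i \<notin> I \<longrightarrow> f i = 0)}"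
      using assms(1) by (intro finite_set_of_finite_funs) auto
    moreover have "S' \<subseteq> {f. \<forall>i. (i \<in> I \<longrightarrow> f i \<in> (\<Union>i\<in>I. (\<lambda>t. t i) ` S')) \<and> (i \<notin> I \<longrightarrow> f i = 0)}"
      using supp S'(1) by blast
    ultimately show False
      using S'(2) finite_subset by blast
  qed
  then obtain i0 where i0: "infinite ((\<lambda>t. t i0) ` S')"
    by blast
  then obtain g :: "nat \<Rightarrow> 'k" where g: "inj g" "range g \<subseteq> (\<lambda>t. t i0) ` S'"
    using infinite_countable_subset by blast
  then have "\<forall>n. \<exists>t\<in>S'. t i0 = g n"
    by (metis (no_types, lifting) imageE rangeI subsetD)
  then obtain x where x: "\<And>n. x n \<in> S'" "\<And>n. x n i0 = g n"
    by metis
  have "i0 \<in> J"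
  proof (rule ccontr)
    assume "i0 \<notin> J"
    then have "(\<lambda>t. t i0) ` S' \<subseteq> {0}"
      using J by auto
    then show False
      using i0 finite_subset by blast
  qed
  then show thesis
    using x J S'(1,3) g(1) by (intro that[of x J i0]) auto
qed

lemma sum_fun_apply: "(\<Sum>i\<in>I. f i) x = (\<Sum>i\<in>I. f i x)"
  by (induction I rule: infinite_finite_induct) auto

text \<open>\<open>s\<close> is the specialisation of the points divided by their dominant
  coordinate \<open>p\<close>. Homogeneous quadratic relations persist, while an affine linear
  relation loses its constant because \<open>c\<close> divided by coordinate \<open>p\<close> has
  value 0.\<close>

lemma point_at_infinity:
  fixes S :: "('i \<Rightarrow> 'k::alg_closed_field) set"
  assumes "finite I" "infinite S" and supp: "\<forall>t\<in>S. \<forall>i. i \<notin> I \<longrightarrow> t i = 0"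
  obtains p s where "p \<in> I" "s p = 1"
    "\<And>i j k l. \<forall>t\<in>S. t i * t j = t k * t l \<Longrightarrow> s i * s j = s k * s l"
    "\<And>b c. \<forall>t\<in>S. (\<Sum>i\<in>I. b i * t i) = c \<Longrightarrow> (\<Sum>i\<in>I. b i * s i) = 0"
proof -
  obtain x :: "nat \<Rightarrow> 'i \<Rightarrow> 'k" and J i0 where
    x: "\<And>n. x n \<in> S" and J: "J \<subseteq> I" and i0: "i0 \<in> J" and inj: "inj (\<lambda>n. x n i0)"
    and nz: "\<And>n i. i \<in> J \<longleftrightarrow> x n i \<noteq> 0"
    using sequence_with_unbounded_coordinate[OF assms] by blast
  define v where "v = (\<lambda>i n. x n i)"
  \<comment> \<open>As \<open>inverse 0 = 0\<close>, these are inverses in the ring of sequences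
    exactly for \<open>i\<close> in \<open>J\<close>.\<close>
  define w where "w = (\<lambda>i n. inverse (x n i))"
  have vw: "v i * w i = 1" if "i \<in> J" for i
    using nz that by (auto simp: v_def w_def fun_eq_iff)
  have v0: "v i = 0" if "i \<notin> J" for i
    using nz that by (auto simp: v_def fun_eq_iff)
  have "inj (w i0)"
    using inj by (simp add: w_def inj_def)
  note hom = partial_hom_at_zero[OF this]
  then obtain G where "maximal_partial_hom G"
    and G: "{((\<lambda>n. poly p (w i0 n)), poly p 0) | p. True} \<subseteq> G"
    by (rule maximal_partial_hom_exists)
  then interpret maximal_partial_hom G by simp
  have "((\<lambda>n. poly [:0, 1:] (w i0 n)), poly [:0, 1:] 0) \<in> G"
    using G by blast
  then have w_i0: "(w i0, 0) \<in> G"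
    by simp
  have const: "((\<lambda>n. b), b) \<in> G" for b
  proof -
    have "((\<lambda>n. poly [:b:] (w i0 n)), poly [:b:] 0) \<in> G"
      using G by blast
    then show ?thesis by simp
  qed
  \<comment> \<open>Totality is the valuation property, since \<open>v i * w j\<close> and
    \<open>v j * w i\<close> are mutually inverse.\<close>
  have "\<exists>p\<in>J. \<forall>i\<in>J. v i * w p \<in> Domain G"
  proof (rule maximal_under_total_transitive)
    show "finite J" "J \<noteq> {}"
      using J assms(1) i0 finite_subset by auto
    show "v i * w j \<in> Domain G \<or> v j * w i \<in> Domain G" if ij: "i \<in> J" "j \<in> J" for i j
    proof -
      have "(v i * w j) * (v j * w i) = (v i * w i) * (v j * w j)"
        by (simp add: mult_ac)
      then show ?thesis
        using valuation_property[of "v i * w j" "v j * w i"] vw ij by auto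
    qed
    show "v i * w k \<in> Domain G"
      if ijk: "j \<in> J" "v i * w j \<in> Domain G" "v j * w k \<in> Domain G" for i j k
    proof -
      have "(v i * w j) * (v j * w k) = (v j * w j) * (v i * w k)"
        by (simp add: mult_ac)
      then show ?thesis
        using ijk(2,3) mult_mem[of "v i * w j" _ "v j * w k"] vw[OF ijk(1)] by (auto simp: Domain_iff)
    qed
  qed
  then obtain p where p: "p \<in> J" "\<And>i. i \<in> J \<Longrightarrow> v i * w p \<in> Domain G"
    by blast
  have "\<exists>c. (v i * w p, c) \<in> G" for i
    using p(2)[of i] v0[of i] zero_mem by (cases "i \<in> J") auto
  then obtain s where s: "\<And>i. (v i * w p, s i) \<in> G"
    by metis
  \<comment> \<open>\<open>w p\<close> is \<open>w i0\<close>, of value 0, times the quotient of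
    coordinate \<open>i0\<close> by the dominant one, of finite value.\<close>
  have w_p: "(w p, 0) \<in> G"
  proof -
    have "w i0 * (v i0 * w p) = (v i0 * w i0) * w p"
      by (simp add: mult_ac)
    then show ?thesis
      using mult_mem[OF w_i0 s[of i0]] vw[OF i0] by simp
  qed
  show thesis
  proof (rule that[of p s])
    show "p \<in> I"
      using p J by blast
    show "s p = 1"
      using unique_value[OF s[of p]] vw[OF p(1)] one_mem by simp
  next
    fix i j k l
    assume "\<forall>t\<in>S. t i * t j = t k * t l"
    then have eq: "v i * v j = v k * v l"
      using x by (auto simp: v_def fun_eq_iff)
    have "(v i * w p) * (v j * w p) = (v i * v j) * (w p * w p)"
      by (simp add: mult_ac)
    also have "\<dots> = (v k * w p) * (v l * w p)"
      unfolding eq by (simp add: mult_ac)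
    finally have "(v i * w p) * (v j * w p) = (v k * w p) * (v l * w p)" .
    then show "s i * s j = s k * s l"
      using unique_value[OF mult_mem[OF s[of i] s[of j]]] mult_mem[OF s[of k] s[of l]] by simp
  next
    fix b c
    assume eq: "\<forall>t\<in>S. (\<Sum>i\<in>I. b i * t i) = c"
    have "(\<Sum>i\<in>I. (\<lambda>n. b i) * (v i * w p)) = (\<lambda>n. c) * w p"
    proof
      fix n
      have "(\<Sum>i\<in>I. (\<lambda>n. b i) * (v i * w p)) n = (\<Sum>i\<in>I. b i * x n i) * w p n"
        by (simp add: sum_fun_apply v_def sum_distrib_left sum_distrib_right mult_ac)
      then show "(\<Sum>i\<in>I. (\<lambda>n. b i) * (v i * w p)) n = ((\<lambda>n. c) * w p) n"
        using bspec[OF eq x[of n]] by simp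
    qed
    moreover have "((\<Sum>i\<in>I. (\<lambda>n. b i) * (v i * w p)), (\<Sum>i\<in>I. b i * s i)) \<in> G"
      by (intro sum_mem mult_mem const s)
    ultimately show "(\<Sum>i\<in>I. b i * s i) = 0"
      using unique_value[of _ "\<Sum>i\<in>I. b i * s i" "c * 0"] mult_mem[OF const[of c] w_p] by simp
  qed
qed

section \<open>Left factors in a finite-dimensional subspace\<close>

text \<open>The set consists of the coordinate matrices of tensors of rank at most one that multiply
  to \<open>a\<close>. If it were infinite, its point at infinity would have vanishing minors, hence
  rank one, and would multiply to 0.\<close>

lemma finite_product_tensors:
  fixes scale :: "'k::alg_closed_field \<Rightarrow> 'b::ring_1_no_zero_divisors \<Rightarrow> 'b" (infixr \<open>*s\<close> 75)
  assumes "assoc_algebra scale"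
    and E: "finite E" "\<not> module.dependent scale E" and F: "finite F" "\<not> module.dependent scale F"
  shows "finite {(\<lambda>(e, f). if e \<in> E \<and> f \<in> F then x e * y f else 0) | x y.
    (\<Sum>e\<in>E. x e *s e) * (\<Sum>f\<in>F. y f *s f) = a}" (is "finite ?S")
proof (rule ccontr)
  interpret assoc_algebra scale by fact
  define S where "S = ?S"
  assume "infinite ?S"
  then have inf: "infinite S"
    by (simp add: S_def)
  have supp: "\<forall>t\<in>S. \<forall>i. i \<notin> E \<times> F \<longrightarrow> t i = 0"
    by (auto simp: S_def)
  obtain p s where p: "p \<in> E \<times> F" "s p = 1"
    and minors: "\<And>i j k l. \<forall>t\<in>S. t i * t j = t k * t l \<Longrightarrow> s i * s j = s k * s l"
    and lin: "\<And>b c. \<forall>t\<in>S. (\<Sum>i\<in>E \<times> F. b i * t i) = c \<Longrightarrow> (\<Sum>i\<in>E \<times> F. b i * s i) = 0"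
    using point_at_infinity[OF finite_cartesian_product[OF E(1) F(1)] inf supp] by blast
  obtain e0 f0 where ef0: "p = (e0, f0)" "e0 \<in> E" "f0 \<in> F"
    using p(1) by blast
  have expand: "(\<Sum>e\<in>E. x e *s e) * (\<Sum>f\<in>F. y f *s f) = (\<Sum>(e, f)\<in>E \<times> F. (x e * y f) *s (e * f))" for x y
    by (simp add: sum_product scale_mult_left scale_mult_right sum.cartesian_product mult.commute)
  \<comment> \<open>The 2-by-2 minor with pivot \<open>(e0, f0)\<close>, whose entry is normalised
    to 1.\<close>
  have s: "s (e, f) = s (e, f0) * s (e0, f)" if "e \<in> E" "f \<in> F" for e f
  proof -
    have "s (e, f) * s (e0, f0) = s (e, f0) * s (e0, f)"
      by (rule minors) (use that ef0 in \<open>auto simp: S_def\<close>)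
    then show ?thesis
      using p(2) ef0(1) by simp
  qed
  \<comment> \<open>A basis of the whole algebra, possibly infinite, splits the equation for the
    product into scalar linear equations.\<close>
  obtain C where C: "independent C" "span C = UNIV"
    using maximal_independent_subset[of UNIV] by (metis top.extremum_uniqueI)
  define Z where "Z = (\<Sum>(e, f)\<in>E \<times> F. s (e, f) *s (e * f))"
  have rep: "representation C (\<Sum>(e, f)\<in>E \<times> F. t (e, f) *s (e * f)) c
      = (\<Sum>i\<in>E \<times> F. representation C (fst i * snd i) c * t i)" for t c
    using C by (simp add: representation_sum representation_scale case_prod_unfold mult.commute)
  have "representation C Z c = 0" for c
    unfolding Z_def rep
  proof (rule lin, rule ballI)
    fix t
    assume "t \<in> S"
    then obtain x y where t: "t = (\<lambda>(e, f). if e \<in> E \<and> f \<in> F then x e * y f else 0)"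
      and a: "(\<Sum>e\<in>E. x e *s e) * (\<Sum>f\<in>F. y f *s f) = a"
      unfolding S_def by blast
    have "(\<Sum>(e, f)\<in>E \<times> F. t (e, f) *s (e * f)) = a"
      unfolding a[symmetric] expand by (rule sum.cong) (auto simp: t)
    then show "(\<Sum>i\<in>E \<times> F. representation C (fst i * snd i) c * t i) = representation C a c"
      using rep[of t c] by simp
  qed
  then have "Z = 0"
    using sum_nonzero_representation_eq[OF C(1), of Z] C(2) by simp
  moreover have "Z = (\<Sum>e\<in>E. s (e, f0) *s e) * (\<Sum>f\<in>F. s (e0, f) *s f)"
    unfolding expand Z_def by (rule sum.cong) (auto simp: s)
  ultimately have "(\<Sum>e\<in>E. s (e, f0) *s e) = 0 \<or> (\<Sum>f\<in>F. s (e0, f) *s f) = 0"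
    by simp
  \<comment> \<open>The coefficients at \<open>e0\<close> and at \<open>f0\<close> both equal
    \<open>s p = 1\<close>, so neither factor can vanish.\<close>
  then show False
    using independentD[OF E(2,1) order.refl _ ef0(2), of "\<lambda>e. s (e, f0)"]
      independentD[OF F(2,1) order.refl _ ef0(3), of "\<lambda>f. s (e0, f)"] p(2) ef0(1) by auto
qed

text \<open>Only finitely many tensors of \<open>x\<close> with a cofactor occur, and since the
  cofactor is nonzero, the tensor determines \<open>x\<close> up to a scalar. \<open>D\<close> takes
  one \<open>x\<close> for each tensor.\<close>

lemma finite_left_factors_up_to_scalars:
  fixes scale :: "'k::alg_closed_field \<Rightarrow> 'b::ring_1_no_zero_divisors \<Rightarrow> 'b" (infixr \<open>*s\<close> 75)
  assumes "assoc_algebra scale"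
    and E: "finite E" "\<not> module.dependent scale E"
    and "a \<noteq> 0"
    and X: "\<And>x. x \<in> X \<Longrightarrow> x \<in> module.span scale E \<and> (\<exists>y\<in>module.span scale E. x * y = a)"
  obtains D where "finite D" "D \<subseteq> X" "\<And>x. x \<in> X \<Longrightarrow> \<exists>d\<in>D. \<exists>c. c \<noteq> 0 \<and> x = c *s d"
proof -
  interpret assoc_algebra scale by fact
  obtain y where y: "\<And>x. x \<in> X \<Longrightarrow> y x \<in> span E" "\<And>x. x \<in> X \<Longrightarrow> x * y x = a"
    using X by metis
  have rep: "(\<Sum>e\<in>E. representation E x e *s e) = x" if "x \<in> span E" for x
    using sum_representation_eq[OF E(2) that E(1) order.refl] .
  define t where "t = (\<lambda>x (e, f). if e \<in> E \<and> f \<in> E then representation E x e * representation E (y x) f else 0)"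
  have "t ` X \<subseteq> {(\<lambda>(e, f). if e \<in> E \<and> f \<in> E then x e * y f else 0) | x y.
    (\<Sum>e\<in>E. x e *s e) * (\<Sum>f\<in>E. y f *s f) = a}" (is "_ \<subseteq> ?S")
  proof
    fix u
    assume "u \<in> t ` X"
    then obtain x where "x \<in> X" "u = t x" by blast
    moreover from this have "(\<Sum>e\<in>E. representation E x e *s e) * (\<Sum>f\<in>E. representation E (y x) f *s f) = a"
      using X y by (simp add: rep)
    ultimately show "u \<in> ?S"
      unfolding t_def by blast
  qed
  then have "finite (t ` X)"
    using finite_product_tensors[OF assms(1) E E] by (rule finite_subset)
  moreover have "\<exists>c. c \<noteq> 0 \<and> x = c *s d" if xd: "x \<in> X" "d \<in> X" "t x = t d" for x d
  proof -
    have "y x \<noteq> 0"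
      using y(2)[OF xd(1)] \<open>a \<noteq> 0\<close> by auto
    then have "\<exists>f\<in>E. representation E (y x) f \<noteq> 0"
      using rep[OF y(1)[OF xd(1)]] by (metis (no_types, lifting) scale_zero_left sum.neutral)
    then obtain f where f: "f \<in> E" "representation E (y x) f \<noteq> 0" by blast
    \<comment> \<open>Obtained by comparing the columns of the two equal matrices at an
      \<open>f\<close> where the cofactor of \<open>x\<close> has a nonzero coordinate.\<close>
    define c where "c = representation E (y d) f / representation E (y x) f"
    have "representation E x e = c * representation E d e" if "e \<in> E" for e
      using fun_cong[OF xd(3), of "(e, f)"] that f by (simp add: t_def c_def field_simps)
    then have "(\<Sum>e\<in>E. representation E x e *s e) = c *s (\<Sum>e\<in>E. representation E d e *s e)"
      by (simp add: scale_sum_right)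
    then have "x = c *s d"
      using X xd by (simp add: rep)
    moreover from this have "c \<noteq> 0"
      using y(2)[OF xd(1)] \<open>a \<noteq> 0\<close> by auto
    ultimately show ?thesis by blast
  qed
  moreover have "inv_into X t (t x) \<in> X" "t x = t (inv_into X t (t x))" if "x \<in> X" for x
    using that by (auto simp: inv_into_into f_inv_into_f)
  ultimately show thesis
    by (intro that[of "inv_into X t ` t ` X"]) blast+
qed

section \<open>Graded domains\<close>

context nat_graded_algebra
begin

section \<open>Homogeneous components and degree\<close>

definition component :: "'b \<Rightarrow> nat \<Rightarrow> 'b" where
  "component b = (THE f. (\<forall>n. f n \<in> G n) \<and> finite {n. f n \<noteq> 0} \<and> b = (\<Sum>n\<in>{n. f n \<noteq> 0}. f n))"

lemma component_mem: "component b n \<in> G n"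
  and finite_component: "finite {n. component b n \<noteq> 0}"
  and sum_component_support: "(\<Sum>n\<in>{n. component b n \<noteq> 0}. component b n) = b"
  using theI'[OF direct_sum[of b]] unfolding component_def[symmetric] by auto

lemma component_eqI:
  assumes "\<And>n. f n \<in> G n" "finite N" "\<And>n. n \<notin> N \<Longrightarrow> f n = 0" "b = (\<Sum>n\<in>N. f n)"
  shows "component b = f"
proof -
  have "{n. f n \<noteq> 0} \<subseteq> N"
    using assms(3) by blast
  then have "finite {n. f n \<noteq> 0}" "b = (\<Sum>n\<in>{n. f n \<noteq> 0}. f n)"
    using assms(2,4) by (auto intro: finite_subset sum.mono_neutral_right)
  then show ?thesis
    unfolding component_def using assms(1) by (intro the1_equality direct_sum) auto
qed

lemma sum_component: "finite N \<Longrightarrow> (\<And>n. n \<notin> N \<Longrightarrow> component b n = 0) \<Longrightarrow> (\<Sum>n\<in>N. component b n) = b"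
  by (subst (2) sum_component_support[symmetric], rule sum.mono_neutral_right) auto

lemma zero_mem_component: "0 \<in> G n"
  using subspace_0[OF subspace_component] .

lemma component_zero: "component 0 = (\<lambda>n. 0)"
  by (rule component_eqI[of _ "{}"]) (auto simp: zero_mem_component)

lemma component_homogeneous:
  assumes "b \<in> G m"
  shows "component b = (\<lambda>n. if n = m then b else 0)"
  by (rule component_eqI[of _ "{m}"]) (use assms in \<open>auto simp: zero_mem_component\<close>)

lemma component_add: "component (a + b) = (\<lambda>n. component a n + component b n)"
proof (rule component_eqI)
  let ?N = "{n. component a n \<noteq> 0} \<union> {n. component b n \<noteq> 0}"
  show "component a n + component b n \<in> G n" for n
    using subspace_add[OF subspace_component component_mem component_mem] .
  show "finite ?N"
    by (simp add: finite_component)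
  then show "a + b = (\<Sum>n\<in>?N. component a n + component b n)"
    unfolding sum.distrib by (subst (1 2) sum_component) auto
qed auto

lemma component_sum: "component (\<Sum>i\<in>I. f i) n = (\<Sum>i\<in>I. component (f i) n)"
  by (induction I rule: infinite_finite_induct) (auto simp: component_zero component_add)

text \<open>The inserted \<open>0\<close> keeps the maximum meaningful for the zero element, which
  gets degree 0.\<close>

definition deg :: "'b \<Rightarrow> nat" where
  "deg b = Max (insert 0 {n. component b n \<noteq> 0})"

lemma component_above_deg: "n > deg b \<Longrightarrow> component b n = 0"
  unfolding deg_def using Max_ge[of "insert 0 {n. component b n \<noteq> 0}" n] finite_component[of b] by fastforce

lemma sum_component_deg: "(\<Sum>n\<le>deg b. component b n) = b"
  by (rule sum_component) (auto intro: component_above_deg)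

lemma component_deg_nonzero:
  assumes "b \<noteq> 0"
  shows "component b (deg b) \<noteq> 0"
proof (cases "deg b = 0")
  case True
  then show ?thesis
    using sum_component_deg[of b] assms by auto
next
  case False
  have "deg b \<in> insert 0 {n. component b n \<noteq> 0}"
    unfolding deg_def using finite_component by (intro Max_in) auto
  then show ?thesis
    using False by simp
qed

lemma deg_eqI: "component b d \<noteq> 0 \<Longrightarrow> (\<And>n. n > d \<Longrightarrow> component b n = 0) \<Longrightarrow> deg b = d"
  using component_above_deg[of b d] component_deg_nonzero[of b] component_zero by (metis linorder_neqE_nat)

lemma component_mult:
  "component (a * b) n = (\<Sum>i\<le>deg a. \<Sum>j\<le>deg b. if n = i + j then component a i * component b j else 0)"
proof -
  have "a * b = (\<Sum>i\<le>deg a. \<Sum>j\<le>deg b. component a i * component b j)"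
    using sum_product[of "component a" "{..deg a}" "component b" "{..deg b}"] by (simp add: sum_component_deg)
  then have "component (a * b) n = (\<Sum>i\<le>deg a. \<Sum>j\<le>deg b. component (component a i * component b j) n)"
    by (simp add: component_sum)
  then show ?thesis
    by (simp add: component_homogeneous[OF mult_component[OF component_mem component_mem]])
qed

text \<open>Elements of degree at most \<open>d\<close> lie in the sum of finitely many
  finite-dimensional components.\<close>

lemma span_of_bounded_degree:
  assumes "\<And>n. finite_dimensional_subspace scale (G n)"
  obtains E where "finite E" "independent E" "\<And>b. deg b \<le> d \<Longrightarrow> b \<in> span E"
proof -
  obtain C where C: "\<And>n. finite (C n)" "\<And>n. span (C n) = G n"
    using assms unfolding finite_dimensional_subspace_def by metis
  obtain E where E: "E \<subseteq> (\<Union>n\<le>d. C n)" "independent E" "(\<Union>n\<le>d. C n) \<subseteq> span E"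
    using maximal_independent_subset .
  show thesis
  proof (rule that)
    show "finite E"
      using E(1) C(1) by (auto intro: finite_subset)
    show "b \<in> span E" if "deg b \<le> d" for b
    proof -
      have "component b n \<in> span E" if "n \<le> deg b" for n
      proof -
        have "C n \<subseteq> span E"
          using E(3) that \<open>deg b \<le> d\<close> by force
        then have "span (C n) \<subseteq> span E"
          by (rule span_minimal) simp
        then show ?thesis
          using component_mem C(2) by blast
      qed
      then have "(\<Sum>n\<le>deg b. component b n) \<in> span E"
        by (intro span_sum) simp
      then show ?thesis
        by (simp add: sum_component_deg)
    qed
  qed (rule E(2))
qed

end

text \<open>\<open>T\<close> is a finite set of labels, not necessarily in \<open>A\<close>.
  Elements sharing a label are equivalent, so one chosen element per label reaches every
  class.\<close>

lemma finite_quotient_by_representatives: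
  assumes R: "equiv A R" and "finite T" and rel: "\<And>x. x \<in> A \<Longrightarrow> \<exists>t\<in>T. S x t"
    and S: "\<And>x y t. x \<in> A \<Longrightarrow> y \<in> A \<Longrightarrow> S x t \<Longrightarrow> S y t \<Longrightarrow> (x, y) \<in> R"
  shows "finite (A // R)"
proof (rule finite_subset)
  show "A // R \<subseteq> (\<lambda>t. R `` {SOME y. y \<in> A \<and> S y t}) ` T"
  proof
    fix X
    assume "X \<in> A // R"
    then obtain x where x: "x \<in> A" "X = R `` {x}"
      by (rule quotientE)
    then obtain t where t: "t \<in> T" "S x t"
      using rel by blast
    let ?y = "SOME y. y \<in> A \<and> S y t"
    have "?y \<in> A \<and> S ?y t"
      by (rule someI[of _ x]) (use x t in auto)
    then have "R `` {x} = R `` {?y}"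
      using S[of x ?y t] x t equiv_class_eq[OF R] by blast
    then show "X \<in> (\<lambda>t. R `` {SOME y. y \<in> A \<and> S y t}) ` T"
      using x t by blast
  qed
qed (use assms(2) in simp)

section \<open>Degree, units and existence of factorizations in a graded domain\<close>

locale graded_domain = nat_graded_algebra scale G
  for scale :: "'k::alg_closed_field \<Rightarrow> 'b::ring_1_no_zero_divisors \<Rightarrow> 'b" (infixr \<open>*s\<close> 75)
    and G :: "nat \<Rightarrow> 'b set" +
  assumes finite_dim: "finite_dimensional_subspace scale (G n)"
begin

text \<open>Without zero divisors the product of the two top components is nonzero.\<close>

lemma deg_mult:
  assumes "a \<noteq> 0" "b \<noteq> 0"
  shows "deg (a * b) = deg a + deg b"
proof (rule deg_eqI)
  have "(if deg a + deg b = i + j then component a i * component b j else 0) =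
      (if i = deg a then if j = deg b then component a i * component b j else 0 else 0)"
    if "i \<le> deg a" "j \<le> deg b" for i j
    using that by auto
  then have "component (a * b) (deg a + deg b) =
      (\<Sum>i\<le>deg a. \<Sum>j\<le>deg b. if i = deg a then if j = deg b then component a i * component b j else 0 else 0)"
    unfolding component_mult by (intro sum.cong refl) simp
  also have "\<dots> = (\<Sum>i\<le>deg a. if i = deg a then (\<Sum>j\<le>deg b. if j = deg b then component a i * component b j else 0) else 0)"
    by (intro sum.cong refl) simp
  also have "\<dots> = component a (deg a) * component b (deg b)"
    by simp
  finally show "component (a * b) (deg a + deg b) \<noteq> 0"
    using assms component_deg_nonzero by simp
  show "component (a * b) n = 0" if "n > deg a + deg b" for n
    unfolding component_mult using that by (intro sum.neutral ballI) auto
qed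

lemma deg_one: "deg 1 = 0"
  using deg_mult[of 1 1] by simp

lemma mem_component_if_deg_0: "deg b = 0 \<Longrightarrow> b \<in> G 0"
  using sum_component_deg[of b] component_mem[of b 0] by simp

text \<open>Left multiplication by \<open>u\<close> is an injective linear map of the
  finite-dimensional space \<open>G 0\<close> into itself, so it attains 1.\<close>

lemma ring_unit_if_deg_0:
  assumes "u \<noteq> 0" "deg u = 0"
  shows "ring_unit u"
proof -
  obtain E where E: "finite E" "independent E" "span E = G 0"
    using finite_dim[of 0] unfolding finite_dimensional_subspace_def by blast
  interpret l: Vector_Spaces.linear scale scale "(*) u"
    by (auto simp: Vector_Spaces.linear_iff distrib_left scale_mult_right vector_space_axioms)
  have inj: "inj ((*) u)"
    using assms(1) by (auto simp: inj_def)
  have ind: "independent ((*) u ` E)"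
    using l.independent_injective_image[OF E(2)] inj by (simp add: inj_on_def inj_def)
  have sub: "(*) u ` E \<subseteq> span E"
    using mult_component[OF mem_component_if_deg_0[OF assms(2)], of _ 0] E(3) span_superset[of E] by force
  have "1 \<in> span ((*) u ` E)"
  proof (rule ccontr)
    \<comment> \<open>Adjoining 1 to the image of the basis \<open>E\<close> would give too many
      independent vectors in \<open>span E\<close>.\<close>
    assume n: "1 \<notin> span ((*) u ` E)"
    then have "independent (insert 1 ((*) u ` E))"
      using ind by (simp add: independent_insert)
    moreover have "insert 1 ((*) u ` E) \<subseteq> span E"
      using sub mem_component_if_deg_0[OF deg_one] E(3) by simp
    ultimately have "card (insert 1 ((*) u ` E)) \<le> card E"
      using independent_span_bound[OF E(1)] by blast
    moreover have "1 \<notin> (*) u ` E"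
      using n span_base by blast
    moreover have "card ((*) u ` E) = card E"
      using inj by (intro card_image) (auto simp: inj_on_def inj_def)
    ultimately show False
      using E(1) by simp
  qed
  then obtain v where v: "u * v = 1"
    unfolding l.span_image by force
  then have "u * (v * u - 1) = 0"
    by (simp add: right_diff_distrib flip: mult.assoc)
  then have "v * u = 1"
    using assms(1) by simp
  then show ?thesis
    using v unfolding ring_unit_def by blast
qed

lemma deg_pos: "x \<noteq> 0 \<Longrightarrow> \<not> ring_unit x \<Longrightarrow> 0 < deg x"
  using ring_unit_if_deg_0 by blast

text \<open>Non-units have positive degree, so both factors of a proper splitting have smaller
  degree.\<close>

lemma factorization_exists:
  fixes a :: 'b
  assumes "a \<noteq> 0" "\<not> ring_unit a"
  shows "factorizations a \<noteq> {}"
  using assms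
proof (induction "deg a" arbitrary: a rule: less_induct)
  case less
  show ?case
  proof (cases "ring_irreducible a")
    case True
    then have "[a] \<in> factorizations a"
      by (simp add: factorizations_def)
    then show ?thesis by blast
  next
    case False
    then obtain b c where bc: "a = b * c" "\<not> ring_unit b" "\<not> ring_unit c"
      using less.prems unfolding ring_irreducible_def by blast
    then have nz: "b \<noteq> 0" "c \<noteq> 0"
      using less.prems by auto
    have "deg b < deg a" "deg c < deg a"
      using deg_pos[OF nz(1) bc(2)] deg_pos[OF nz(2) bc(3)] deg_mult[OF nz] bc(1) by simp_all
    then obtain xs ys where "xs \<in> factorizations b" "ys \<in> factorizations c"
      using less.hyps nz bc(2,3) by blast
    then have "xs @ ys \<in> factorizations a"
      using bc(1) by (auto simp: factorizations_def)
    then show ?thesis by blast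
  qed
qed

section \<open>Finiteness of factorizations\<close>

definition scalar_multiple :: "'b \<Rightarrow> 'b \<Rightarrow> bool" where
  "scalar_multiple x y \<longleftrightarrow> (\<exists>c. c \<noteq> 0 \<and> x = c *s y)"

text \<open>Nonzero scalar multiples of 1 are central units.\<close>

lemma central_unit_multiple_if_common_scalar_multiple:
  assumes "scalar_multiple x t" "scalar_multiple y t"
  shows "\<exists>u. central_unit u \<and> y = u * x"
proof -
  obtain c d where cd: "c \<noteq> 0" "x = c *s t" "d \<noteq> 0" "y = d *s t"
    using assms by (auto simp: scalar_multiple_def)
  define u where "u = (d / c) *s (1 :: 'b)"
  have "(c / d) * (d / c) = 1"
    using cd(1,3) by simp
  then have "u * ((c / d) *s 1) = 1" "((c / d) *s 1) * u = 1"
    unfolding u_def scale_mult_left scale_mult_right mult_1_right scale_scale by (simp_all add: mult.commute)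
  moreover have "u * z = z * u" for z
    by (simp add: u_def scale_mult_left scale_mult_right)
  ultimately have "central_unit u"
    unfolding central_unit_def ring_unit_def by blast
  moreover have "y = u * x"
    using cd by (simp add: u_def scale_mult_left)
  ultimately show ?thesis by blast
qed

text \<open>
  Scalar multiples of \<open>a\<close> are included because the cofactor of a chosen left factor is determined
  only up to a scalar.
\<close>

definition covers :: "'b list set \<Rightarrow> 'b \<Rightarrow> bool" where
  "covers T a \<longleftrightarrow> (\<forall>xs c. c \<noteq> 0 \<longrightarrow> (\<forall>x\<in>set xs. ring_irreducible x) \<longrightarrow>
    prod_list xs = c *s a \<longrightarrow> (\<exists>t\<in>T. list_all2 scalar_multiple xs t))"

lemma coversD:
  assumes "covers T a" "c \<noteq> 0" "\<forall>x\<in>set xs. ring_irreducible x" "prod_list xs = c *s a"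
  shows "\<exists>t\<in>T. list_all2 scalar_multiple xs t"
  using assms unfolding covers_def by blast

text \<open>Up to scalars there are finitely many irreducible left factors \<open>d\<close> of
  \<open>a\<close>, and each cofactor \<open>y d\<close> has smaller degree; covers of the
  cofactors, prefixed by \<open>d\<close>, form a cover of \<open>a\<close>.\<close>

lemma finite_cover_exists:
  assumes "a \<noteq> 0"
  shows "\<exists>T. finite T \<and> covers T a"
  using assms
proof (induction "deg a" arbitrary: a rule: less_induct)
  case less
  let ?X = "{x. ring_irreducible x \<and> (\<exists>y. x * y = a)}"
  obtain E where E: "finite E" "independent E" "\<And>b. deg b \<le> deg a \<Longrightarrow> b \<in> span E"
    using span_of_bounded_degree[OF finite_dim, of "deg a"] by blast
  have "x \<in> span E \<and> (\<exists>y\<in>span E. x * y = a)" if x: "x \<in> ?X" for x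
  proof -
    obtain y where y: "x * y = a"
      using x by blast
    then have "deg x + deg y = deg a"
      using less.prems deg_mult[of x y] by auto
    then show ?thesis
      using y E(3) by auto
  qed
  then obtain D where D: "finite D" "D \<subseteq> ?X" "\<And>x. x \<in> ?X \<Longrightarrow> \<exists>d\<in>D. \<exists>c. c \<noteq> 0 \<and> x = c *s d"
    using finite_left_factors_up_to_scalars[OF assoc_algebra_axioms E(1,2) less.prems, of ?X] by blast
  have "\<forall>d\<in>D. \<exists>y. d * y = a"
    using D(2) by blast
  then obtain y where y: "\<And>d. d \<in> D \<Longrightarrow> d * y d = a"
    by metis
  have "\<exists>T. finite T \<and> covers T (y d)" if "d \<in> D" for d
  proof (rule less.hyps)
    have nz: "d \<noteq> 0" "y d \<noteq> 0"
      using y[OF that] less.prems by auto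
    moreover have "0 < deg d"
      using D(2) that by (intro deg_pos) (auto simp: ring_irreducible_def)
    ultimately show "deg (y d) < deg a" "y d \<noteq> 0"
      using deg_mult[OF nz] y[OF that] by simp_all
  qed
  then obtain T where T: "\<And>d. d \<in> D \<Longrightarrow> finite (T d)" "\<And>d. d \<in> D \<Longrightarrow> covers (T d) (y d)"
    by metis
  show ?case
    unfolding covers_def
  proof (intro exI conjI allI impI)
    \<comment> \<open>The empty list serves the case in which \<open>c *s a\<close> is the empty
      product 1.\<close>
    show "finite (insert [] (\<Union>d\<in>D. (#) d ` T d))"
      using D(1) T(1) by simp
    fix xs c
    assume c: "c \<noteq> 0" and irr: "\<forall>x\<in>set xs. ring_irreducible x" and prod: "prod_list xs = c *s a"
    show "\<exists>t\<in>insert [] (\<Union>d\<in>D. (#) d ` T d). list_all2 scalar_multiple xs t"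
    proof (cases xs)
      case (Cons x xs')
      \<comment> \<open>Moving the scalar to the cofactor makes \<open>x\<close> a left factor of
        \<open>a\<close> itself.\<close>
      have "x * (inverse c *s prod_list xs') = a"
        using prod c Cons by (simp add: scale_mult_right)
      then have "x \<in> ?X"
        using irr Cons by auto
      then obtain d b where d: "d \<in> D" "b \<noteq> 0" "x = b *s d"
        using D(3) by blast
      have "d \<noteq> 0"
        using y[OF d(1)] less.prems by auto
      \<comment> \<open>Cancelling \<open>d\<close> shows that the remaining product is a scalar
        multiple of \<open>y d\<close>, to which the cover of \<open>y d\<close> applies.\<close>
      have "d * (b *s prod_list xs') = d * (c *s y d)"
        using prod Cons d y by (simp add: scale_mult_left scale_mult_right)
      then have "b *s prod_list xs' = c *s y d"
        using \<open>d \<noteq> 0\<close> by simp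
      then have "inverse b *s b *s prod_list xs' = (inverse b * c) *s y d"
        by simp
      then have "prod_list xs' = (inverse b * c) *s y d"
        using d(2) by simp
      then obtain t where "t \<in> T d" "list_all2 scalar_multiple xs' t"
        using coversD[OF T(2)[OF d(1)], of "inverse b * c" xs'] c d(2) irr Cons by auto
      then show ?thesis
        using d Cons by (intro bexI[of _ "d # t"]) (auto simp: scalar_multiple_def)
    qed simp
  qed
qed

theorem is_finite_factorization_domain: "finite_factorization_domain TYPE('b)"
  unfolding finite_factorization_domain_def
proof (intro allI impI conjI)
  fix a :: 'b
  assume a: "a \<noteq> 0 \<and> \<not> ring_unit a"
  then show "factorizations a \<noteq> {}"
    by (intro factorization_exists) auto
  obtain T where T: "finite T" "covers T a"
    using finite_cover_exists[of a] a by blast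
  show "finite (factorizations a // factorization_rel a)"
  proof (rule finite_quotient_by_representatives[OF equiv_factorization_rel T(1)])
    show "\<exists>t\<in>T. list_all2 scalar_multiple xs t" if "xs \<in> factorizations a" for xs
      using coversD[OF T(2), of 1 xs] that by (auto simp: factorizations_def)
    show "(xs, ys) \<in> factorization_rel a"
      if "xs \<in> factorizations a" "ys \<in> factorizations a"
        "list_all2 scalar_multiple xs t" "list_all2 scalar_multiple ys t" for xs ys t
    proof -
      have "list_all2 (\<lambda>x y. \<exists>u. central_unit u \<and> y = u * x) xs ys"
        using that(3,4) central_unit_multiple_if_common_scalar_multiple
        unfolding list_all2_conv_all_nth by metis
      then show ?thesis
        using that(1,2) by (simp add: factorization_rel_def)
    qed
  qed
qed

end

theorem corollary3p8:
  fixes scale :: "'k::alg_closed_field \<Rightarrow> 'b::ring_1_no_zero_divisors \<Rightarrow> 'b"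
    and B :: "nat \<Rightarrow> 'b set"
  assumes "nat_graded_algebra scale B"
    and "\<And>n. finite_dimensional_subspace scale (B n)"
  shows "finite_factorization_domain TYPE('b)"
proof -
  interpret graded_domain scale B
    using assms by (simp add: graded_domain_def graded_domain_axioms_def)
  show ?thesis
    by (rule is_finite_factorization_domain)
qed

end
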